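(* Let $V=\{v_1,\dots,v_m\}\subset\mathbb{R}^n/\mathbb{R}\mathbf 1$ and $\Lambda\in[0,1]^m$. For any $x^0\in C$, where $C$ is a closed, bounded cell of $\mathscr{C}(V,\Lambda)$, there exist weights $w'\in\mathbb{R}^m_{\ge0}$, $w'\ne\mathbf 0$, and biases $\Lambda'\in[0,1]^m$ such that $x^0\in\mathrm{TFW}(V,\Lambda',w')^*$.
   Context: $\mathbb{R}^n/\mathbb{R}\mathbf 1$ is the tropical projective torus (vectors modulo adding a multiple of $\mathbf 1=(1,\dots,1)$). For $x,y\in\mathbb{R}^n/\mathbb{R}\mathbf 1$ and $\lambda\in[0,1]$, $$\mathrm{d}_{\mathrm{tr}}^\lambda(x,y)=\lambda n\max_j(x_j-y_j)-(1-\lambda)n\min_j(x_j-y_j)+(1-2\lambda)\sum_j(x_j-y_j).$$ For weights $w\in\mathbb{R}^m_{\ge0}$ and biases $\Lambda=(\lambda_1,\dots,\lambda_m)\in[0,1]^m$, $\mathrm{TFW}(V,\Lambda,w)^*$ denotes the set of minimizers over $x\in\mathbb{R}^n/\mathbb{R}\mathbf 1$ of $\sum_{i=1}^m w_i\,\mathrm{d}_{\mathrm{tr}}^{\lambda_i}(x,v_i)$. Sectors: for $v\in\mathbb{R}^n$ and $j\in[n]$, the closed max-plus and min-plus sectors with apex $v$ are $S_j^{\max}(-v)=\{x\in\mathbb{R}^n: x_j-v_j\ge x_k-v_k\ \forall k\in[n]\}$ and $S_j^{\min}(-v)=\{x\in\mathbb{R}^n: x_j-v_j\le x_k-v_k\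 \forall k\in[n]\}$. Cellular decomposition: for $\lambda\in[0,1]$ let $\mathcal{N}_\lambda$ be the complete fan in $\mathbb{R}^n$ (each cone invariant under translation by $\mathbb{R}\mathbf 1$) whose maximal cones are: the full-dimensional intersections $S_j^{\max}(\mathbf 0)\cap S_k^{\min}(\mathbf 0)$, $j\ne k$, if $0<\lambda<1$; the sectors $S_j^{\max}(\mathbf 0)$ if $\lambda=0$; the sectors $S_j^{\min}(\mathbf 0)$ if $\lambda=1$. (This is the normal fan of the polar of the unit ball of the gauge $\gamma^\lambda_{\mathrm{tr}}(x)=\mathrm{d}^\lambda_{\mathrm{tr}}(\mathbf 0,x)$.) $\mathscr{C}(V,\Lambda)$ is the common refinement of the translated fans $v_i+\mathcal{N}_{\lambda_i}$, $i\in[m]$; its cells are the nonempty intersections $\bigcap_{i=1}^m(v_i+\sigma_i)$ with $\sigma_i$ a cone of $\mathcal{N}_{\lambda_i}$. A cell is called bounded if its image in $\mathbb{R}^n/\mathbb{R}\mathbf 1\cong\mathbb{R}^{n-1}$ is bounded. *)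

theory Defs
  imports "HOL-Analysis.Analysis"
begin

definition tp_equiv :: "real^'n \<Rightarrow> real^'n \<Rightarrow> bool" where
  "tp_equiv x y \<longleftrightarrow> (\<exists>a::real. y = x + a *\<^sub>R 1)"

lemma equivp_tp_equiv: "equivp (tp_equiv :: real^'n \<Rightarrow> real^'n \<Rightarrow> bool)"
proof (rule equivpI)
  show "reflp (tp_equiv :: real^'n \<Rightarrow> real^'n \<Rightarrow> bool)"
    unfolding reflp_def tp_equiv_def by (metis add.right_neutral scaleR_zero_left)
  show "symp (tp_equiv :: real^'n \<Rightarrow> real^'n \<Rightarrow> bool)"
  proof (rule sympI)
    fix x y :: "real^'n"
    assume "tp_equiv x y"
    then obtain a where "y = x + a *\<^sub>R 1" by (auto simp: tp_equiv_def)
    then have "x = y + (- a) *\<^sub>R 1" by simp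
    then show "tp_equiv y x" unfolding tp_equiv_def by blast
  qed
  show "transp (tp_equiv :: real^'n \<Rightarrow> real^'n \<Rightarrow> bool)"
  proof (rule transpI)
    fix x y z :: "real^'n"
    assume "tp_equiv x y" "tp_equiv y z"
    then obtain a b where "y = x + a *\<^sub>R 1" "z = y + b *\<^sub>R 1" by (auto simp: tp_equiv_def)
    then have "z = x + (a + b) *\<^sub>R 1" by (simp add: scaleR_left_distrib add.assoc)
    then show "tp_equiv x z" unfolding tp_equiv_def by blast
  qed
qed

text \<open>The tropical projective torus \<open>\<real>\<^sup>n / \<real>1\<close>, with \<open>n = CARD('n)\<close>.\<close>

quotient_type (overloaded) 'n tptorus = "real^('n::finite)" / tp_equiv
  by (rule equivp_tp_equiv)

lift_definition tp_class :: "real^'n \<Rightarrow> 'n tptorus" is "\<lambda>x. x" .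

lift_definition d_tr :: "real \<Rightarrow> ('n::finite) tptorus \<Rightarrow> 'n tptorus \<Rightarrow> real" is
  "\<lambda>l x y :: real^'n.
     l * real CARD('n) * Max (range (\<lambda>j. x $ j - y $ j))
     - (1 - l) * real CARD('n) * Min (range (\<lambda>j. x $ j - y $ j))
     + (1 - 2 * l) * (\<Sum>j\<in>UNIV. x $ j - y $ j)"
proof -
  fix l :: real and x x' y y' :: "real^'n"
  assume "tp_equiv x x'" "tp_equiv y y'"
  then obtain a b where "x' = x + a *\<^sub>R 1" "y' = y + b *\<^sub>R 1" by (auto simp: tp_equiv_def)
  then have diff: "x' $ j - y' $ j = (x $ j - y $ j) + (a - b)" for j by simp
  have "Max (range (\<lambda>j. x' $ j - y' $ j)) = Max (range (\<lambda>j. x $ j - y $ j)) + (a - b)"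
    unfolding diff by (rule Max_add_commute) auto
  moreover have "Min (range (\<lambda>j. x' $ j - y' $ j)) = Min (range (\<lambda>j. x $ j - y $ j)) + (a - b)"
    unfolding diff by (rule Min_add_commute) auto
  moreover have "(\<Sum>j\<in>UNIV. x' $ j - y' $ j) = (\<Sum>j\<in>UNIV. x $ j - y $ j) + real CARD('n) * (a - b)"
    unfolding diff by (subst sum.distrib) simp
  ultimately show "l * real CARD('n) * Max (range (\<lambda>j. x $ j - y $ j))
     - (1 - l) * real CARD('n) * Min (range (\<lambda>j. x $ j - y $ j))
     + (1 - 2 * l) * (\<Sum>j\<in>UNIV. x $ j - y $ j) =
     l * real CARD('n) * Max (range (\<lambda>j. x' $ j - y' $ j))
     - (1 - l) * real CARD('n) * Min (range (\<lambda>j. x' $ j - y' $ j))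
     + (1 - 2 * l) * (\<Sum>j\<in>UNIV. x' $ j - y' $ j)"
    by (simp only:) (simp add: algebra_simps)
qed

text \<open>The linear isomorphism from \<open>\<real>\<^sup>n / \<real>1\<close> onto the hyperplane of vectors with
  coordinate sum 0.  It is used only to say what a bounded subset of the torus is.\<close>

lift_definition tp_coords :: "('n::finite) tptorus \<Rightarrow> real^'n" is
  "\<lambda>x :: real^'n. \<chi> i. x $ i - (\<Sum>j\<in>UNIV. x $ j) / real CARD('n)"
  by (auto simp: tp_equiv_def vec_eq_iff sum.distrib add_divide_distrib)

definition TFW :: "('m::finite \<Rightarrow> 'n tptorus) \<Rightarrow> real^'m \<Rightarrow> real^'m \<Rightarrow> ('n::finite) tptorus set" where
  "TFW V L w = {x. \<forall>y. (\<Sum>i\<in>UNIV. w $ i * d_tr (L $ i) x (V i))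
                     \<le> (\<Sum>i\<in>UNIV. w $ i * d_tr (L $ i) y (V i))}"

text \<open>Sectors are indexed by their apex \<open>v\<close>, i.e. \<open>max_sector v j\<close> is
  \<open>S\<^sub>j\<^sup>m\<^sup>a\<^sup>x(-v)\<close>.\<close>

definition max_sector :: "real^'n \<Rightarrow> 'n \<Rightarrow> (real^'n) set" where
  "max_sector v j = {x. \<forall>k. x $ j - v $ j \<ge> x $ k - v $ k}"

definition min_sector :: "real^'n \<Rightarrow> 'n \<Rightarrow> (real^'n) set" where
  "min_sector v j = {x. \<forall>k. x $ j - v $ j \<le> x $ k - v $ k}"

text \<open>For \<open>j \<noteq> k\<close> the intersection of the max-sector \<open>j\<close> and the min-sector \<open>k\<close> at the
  origin is always full-dimensional.\<close>

definition fan_max_cones :: "real \<Rightarrow> (real^'n) set set" where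
  "fan_max_cones l =
     (if l = 0 then range (max_sector 0)
      else if l = 1 then range (min_sector 0)
      else {max_sector 0 j \<inter> min_sector 0 k | j k. j \<noteq> k})"

definition fan :: "real \<Rightarrow> (real^'n) set set" where
  "fan l = {s. s \<noteq> {} \<and> (\<exists>M\<in>fan_max_cones l. s face_of M)}"

definition cells :: "('m::finite \<Rightarrow> real^'n) \<Rightarrow> real^'m \<Rightarrow> (real^'n) set set" where
  "cells v L = {C. C \<noteq> {} \<and>
     (\<exists>s. (\<forall>i. s i \<in> fan (L $ i)) \<and> C = (\<Inter>i. (+) (v i) ` s i))}"

definition bounded_cell :: "(real^'n) set \<Rightarrow> bool" where
  "bounded_cell C \<longleftrightarrow> bounded (tp_coords ` tp_class ` C)"

end

theory Submission
  imports Defs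
begin

text \<open>Let \<open>J\<close> and \<open>K\<close> collect the coordinates at which some \<open>x0 - v i\<close> attains its maximum,
  respectively its minimum.  If \<open>J\<close> and \<open>K\<close> are disjoint, then moving \<open>x0\<close> along the indicator
  vector of \<open>J\<close> keeps all argmax and argmin sets, hence never leaves the cell, which is therefore
  unbounded.  Otherwise some \<open>j\<close> is an argmax for \<open>v i\<close> and an argmin for \<open>v i'\<close>, and then \<open>x0\<close>
  minimizes \<open>d_tr 1 x (v i) + d_tr 0 x (v i')\<close>: the maximum and minimum are bounded by the
  \<open>j\<close>-th entries, which gives a constant lower bound attained at \<open>x0\<close>.\<close>

lemma tp_class_surj: "\<exists>z. y = tp_class z"
  by transfer (auto intro: equivp_reflp[OF equivp_tp_equiv])

text \<open>The subtracted mean cancels. Coordinate differences therefore let boundedness in the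
  torus be tested on representatives.\<close>

lemma tp_coords_diff:
  "tp_coords (tp_class x) $ a - tp_coords (tp_class x) $ b = x $ a - x $ b"
  by transfer simp

lemma d_tr_1:
  fixes x y :: "real^'n"
  shows "d_tr 1 (tp_class x) (tp_class y) =
    real CARD('n) * Max (range (\<lambda>j. x $ j - y $ j)) - (\<Sum>j\<in>UNIV. x $ j - y $ j)"
  by transfer simp

lemma d_tr_0:
  fixes x y :: "real^'n"
  shows "d_tr 0 (tp_class x) (tp_class y) =
    (\<Sum>j\<in>UNIV. x $ j - y $ j) - real CARD('n) * Min (range (\<lambda>j. x $ j - y $ j))"
  by transfer simp

text \<open>\<open>d_tr\<close> is affine in the bias. This covers the case where one point supplies
  both the maximum and the minimum: it can carry only one bias.\<close>

lemma d_tr_half: "2 * d_tr (1 / 2) x y = d_tr 1 x y + d_tr 0 x y"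
  by transfer (simp add: algebra_simps)

lemma max_sector_iff_Max:
  fixes x v :: "real^'n"
  shows "x \<in> max_sector v j \<longleftrightarrow> Max (range (\<lambda>k. x $ k - v $ k)) = x $ j - v $ j"
  by (auto simp: max_sector_def eq_Max_iff eq_commute[of "Max _"])

lemma min_sector_iff_Min:
  fixes x v :: "real^'n"
  shows "x \<in> min_sector v j \<longleftrightarrow> Min (range (\<lambda>k. x $ k - v $ k)) = x $ j - v $ j"
  by (auto simp: min_sector_def eq_Min_iff eq_commute[of "Min _"])

text \<open>The coordinate sums of \<open>x\<close> cancel between the two distances, so
  \<open>x\<close> enters only through a maximum minus a minimum; comparing both with their entries
  at \<open>j\<close> eliminates it.\<close>

lemma d_tr_1_add_d_tr_0_ge:
  fixes x u v :: "real^'n"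
  shows "real CARD('n) * (v $ j - u $ j) + (\<Sum>k\<in>UNIV. u $ k - v $ k)
    \<le> d_tr 1 (tp_class x) (tp_class u) + d_tr 0 (tp_class x) (tp_class v)"
proof -
  have "x $ j - u $ j \<le> Max (range (\<lambda>k. x $ k - u $ k))"
    and "Min (range (\<lambda>k. x $ k - v $ k)) \<le> x $ j - v $ j"
    by auto
  then have "v $ j - u $ j \<le> Max (range (\<lambda>k. x $ k - u $ k)) - Min (range (\<lambda>k. x $ k - v $ k))"
    by linarith
  then have "real CARD('n) * (v $ j - u $ j)
      \<le> real CARD('n) * (Max (range (\<lambda>k. x $ k - u $ k)) - Min (range (\<lambda>k. x $ k - v $ k)))"
    by (rule mult_left_mono) simp
  then show ?thesis
    by (simp add: d_tr_1 d_tr_0 sum_subtractf right_diff_distrib)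
qed

lemma d_tr_1_add_d_tr_0_eq:
  fixes x u v :: "real^'n"
  assumes "x \<in> max_sector u j" "x \<in> min_sector v j"
  shows "d_tr 1 (tp_class x) (tp_class u) + d_tr 0 (tp_class x) (tp_class v)
    = real CARD('n) * (v $ j - u $ j) + (\<Sum>k\<in>UNIV. u $ k - v $ k)"
proof -
  have "Max (range (\<lambda>k. x $ k - u $ k)) = x $ j - u $ j"
    and "Min (range (\<lambda>k. x $ k - v $ k)) = x $ j - v $ j"
    using assms by (auto simp: max_sector_iff_Max min_sector_iff_Min)
  then show ?thesis
    by (simp add: d_tr_1 d_tr_0 sum_subtractf right_diff_distrib)
qed

lemma exists_TFW_of_common_sector:
  fixes v :: "'m::finite \<Rightarrow> real^'n"
  assumes x: "x \<in> max_sector (v i) j" "x \<in> min_sector (v i') j"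
  shows "\<exists>w L :: real^'m. (\<forall>i. 0 \<le> w $ i) \<and> w \<noteq> 0 \<and> (\<forall>i. L $ i \<in> {0..1})
           \<and> tp_class x \<in> TFW (\<lambda>i. tp_class (v i)) L w"
proof -
  \<comment> \<open>If \<open>i = i'\<close>, that point has weight 2 and bias 1/2; otherwise
    \<open>i\<close> has bias 1, \<open>i'\<close> has bias 0, and both have weight 1.\<close>
  define w :: "real^'m" where "w = (\<chi> k. of_bool (k = i) + of_bool (k = i'))"
  define L :: "real^'m" where "L = (\<chi> k. if k = i then if i = i' then 1 / 2 else 1 else 0)"
  have obj: "(\<Sum>k\<in>UNIV. w $ k * d_tr (L $ k) y (tp_class (v k)))
      = d_tr 1 y (tp_class (v i)) + d_tr 0 y (tp_class (v i'))" for y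
  proof -
    have "(\<Sum>k\<in>UNIV. w $ k * d_tr (L $ k) y (tp_class (v k)))
        = (\<Sum>k\<in>UNIV. (if k = i then d_tr (L $ i) y (tp_class (v i)) else 0)
            + (if k = i' then d_tr (L $ i') y (tp_class (v i')) else 0))"
      by (rule sum.cong) (auto simp: w_def)
    also have "\<dots> = d_tr (L $ i) y (tp_class (v i)) + d_tr (L $ i') y (tp_class (v i'))"
      by (simp add: sum.distrib)
    also have "\<dots> = d_tr 1 y (tp_class (v i)) + d_tr 0 y (tp_class (v i'))"
      using d_tr_half[of y "tp_class (v i)"] by (auto simp: L_def)
    finally show ?thesis .
  qed
  have "tp_class x \<in> TFW (\<lambda>i. tp_class (v i)) L w"
    unfolding TFW_def obj
  proof (intro CollectI allI)
    fix y :: "'n tptorus"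
    obtain z where "y = tp_class z"
      using tp_class_surj by blast
    then show "d_tr 1 (tp_class x) (tp_class (v i)) + d_tr 0 (tp_class x) (tp_class (v i'))
        \<le> d_tr 1 y (tp_class (v i)) + d_tr 0 y (tp_class (v i'))"
      using d_tr_1_add_d_tr_0_eq[OF x] d_tr_1_add_d_tr_0_ge by metis
  qed
  moreover have "w $ i \<noteq> 0"
    by (simp add: w_def)
  then have "w \<noteq> 0"
    by auto
  moreover have "\<forall>k. 0 \<le> w $ k" "\<forall>k. L $ k \<in> {0..1}"
    by (auto simp: w_def L_def)
  ultimately show ?thesis
    by blast
qed

lemma exists_gap:
  fixes y :: "real^'n"
  obtains e where "e > 0" "\<And>a b. y $ a < y $ b \<Longrightarrow> e \<le> y $ b - y $ a"
proof -
  \<comment> \<open>The extra element 1 keeps \<open>G\<close> nonempty when all coordinates of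
    \<open>y\<close> are equal.\<close>
  define G where "G = insert 1 ((\<lambda>(a, b). y $ b - y $ a) ` {(a, b). y $ a < y $ b})"
  have "finite G"
    by (simp add: G_def)
  then have "Min G > 0"
    by (subst Min_gr_iff) (auto simp: G_def)
  moreover have "Min G \<le> y $ b - y $ a" if "y $ a < y $ b" for a b
    using \<open>finite G\<close> that by (intro Min_le) (auto simp: G_def)
  ultimately show ?thesis
    using that by blast
qed

text \<open>Staying in a maximal cone is not enough, since \<open>s\<close> may be a proper face.
  But \<open>y\<close> can move a little backwards as well as forwards inside the maximal cone, so
  it lies in an open segment there, and a face containing \<open>y\<close> contains both
  endpoints.\<close>

lemma fan_add_indicator:
  fixes y :: "real^'n"
  assumes s: "s \<in> fan l" and y: "y \<in> s" and t: "t > 0"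
    and J: "\<And>j. y \<in> max_sector 0 j \<Longrightarrow> j \<in> J"
    and K: "\<And>k. y \<in> min_sector 0 k \<Longrightarrow> k \<notin> J"
  shows "y + t *\<^sub>R (\<chi> k. of_bool (k \<in> J)) \<in> s"
proof -
  let ?d = "\<chi> k. of_bool (k \<in> J) :: real^'n"
  obtain M where M: "M \<in> fan_max_cones l" and face: "s face_of M"
    using s by (auto simp: fan_def)
  have yM: "y \<in> M"
    using face y face_of_imp_subset by blast
  obtain e where e: "e > 0" "\<And>a b. y $ a < y $ b \<Longrightarrow> e \<le> y $ b - y $ a"
    using exists_gap[of y] by blast
  \<comment> \<open>For \<open>c\<close> at least 0 the entries in \<open>J\<close> only gain on the
    others. For negative \<open>c\<close> they lose at most \<open>e\<close>, and every entry
    outside \<open>J\<close> is at least \<open>e\<close> below the maximum.\<close>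
  have mx: "y + c *\<^sub>R ?d \<in> max_sector 0 j" if "y \<in> max_sector 0 j" "- e \<le> c" for j c
  proof -
    have *: "j \<in> J" "\<And>k. y $ k \<le> y $ j"
      using that J by (auto simp: max_sector_def)
    have "c + y $ j \<ge> y $ k" if "k \<notin> J" for k
    proof -
      have "y $ k \<noteq> y $ j"
        using that J[of k] *(2) by (auto simp: max_sector_def)
      then have "e \<le> y $ j - y $ k"
        using *(2)[of k] by (intro e) simp
      then show ?thesis
        using \<open>- e \<le> c\<close> by simp
    qed
    then show ?thesis
      using * by (auto simp: max_sector_def add.commute)
  qed
  have mn: "y + c *\<^sub>R ?d \<in> min_sector 0 j" if "y \<in> min_sector 0 j" "- e \<le> c" for j c
  proof -
    have *: "j \<notin> J" "\<And>k. y $ j \<le> y $ k"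
      using that K by (auto simp: min_sector_def)
    have "c + y $ k \<ge> y $ j" if "k \<in> J" for k
    proof -
      have "y $ j \<noteq> y $ k"
        using that K[of k] *(2) by (auto simp: min_sector_def)
      then have "e \<le> y $ k - y $ j"
        using *(2)[of k] by (intro e) simp
      then show ?thesis
        using \<open>- e \<le> c\<close> by simp
    qed
    then show ?thesis
      using * by (auto simp: min_sector_def add.commute)
  qed
  have inM: "y + c *\<^sub>R ?d \<in> M" if "- e \<le> c" for c
    using M yM mx[OF _ that] mn[OF _ that] by (auto simp: fan_max_cones_def split: if_splits)
  show ?thesis
  proof (cases "?d = 0")
    case False
    \<comment> \<open>The parameter at which \<open>y\<close> divides the segment from offset
      \<open>- e\<close> to offset \<open>t\<close>.\<close>
    define u where "u = e / (e + t)"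
    have u: "0 < u" "u < 1" "u * (e + t) - e = 0"
      using e(1) t by (auto simp: u_def)
    have "(1 - u) *\<^sub>R (y + (- e) *\<^sub>R ?d) + u *\<^sub>R (y + t *\<^sub>R ?d) = y + (u * (e + t) - e) *\<^sub>R ?d"
      by (simp add: vec_eq_iff algebra_simps)
    then have "y = (1 - u) *\<^sub>R (y + (- e) *\<^sub>R ?d) + u *\<^sub>R (y + t *\<^sub>R ?d)"
      by (simp only: u(3) scaleR_zero_left add_0_right)
    moreover have "y + (- e) *\<^sub>R ?d \<noteq> y + t *\<^sub>R ?d"
    proof
      assume "y + (- e) *\<^sub>R ?d = y + t *\<^sub>R ?d"
      then have "(- e) *\<^sub>R ?d = t *\<^sub>R ?d"
        by (rule add_left_imp_eq)
      then show False
        using False e(1) t by (simp only: scaleR_cancel_right) simp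
    qed
    ultimately have "y \<in> open_segment (y + (- e) *\<^sub>R ?d) (y + t *\<^sub>R ?d)"
      unfolding in_segment using u by blast
    moreover have "y + (- e) *\<^sub>R ?d \<in> M" "y + t *\<^sub>R ?d \<in> M"
      using e(1) t by (auto intro: inM simp del: scaleR_minus_left)
    ultimately show ?thesis
      using face y unfolding face_of_def by blast
  qed (use y in simp)
qed

lemma common_sector_of_bounded_cell:
  fixes v :: "'m::finite \<Rightarrow> real^'n"
  assumes C: "C \<in> cells v L" and bd: "bounded_cell C" and x: "x \<in> C"
  shows "\<exists>i i' j. x \<in> max_sector (v i) j \<and> x \<in> min_sector (v i') j"
proof (rule ccontr)
  assume disj: "\<nexists>i i' j. x \<in> max_sector (v i) j \<and> x \<in> min_sector (v i') j"
  define J where "J = {j. \<exists>i. x \<in> max_sector (v i) j}"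
  define d :: "real^'n" where "d = (\<chi> k. of_bool (k \<in> J))"
  obtain s where s: "\<And>i. s i \<in> fan (L $ i)" and Cs: "C = (\<Inter>i. (+) (v i) ` s i)"
    using C by (auto simp: cells_def)
  have ray: "x + t *\<^sub>R d \<in> C" if "t > 0" for t
    unfolding Cs
  proof
    fix i
    have "x \<in> (+) (v i) ` s i"
      using x Cs by blast
    then have "x - v i \<in> s i"
      by auto
    then have "(x - v i) + t *\<^sub>R d \<in> s i"
      unfolding d_def using \<open>t > 0\<close>
    proof (rule fan_add_indicator[OF s])
      show "j \<in> J" if "x - v i \<in> max_sector 0 j" for j
        using that by (auto simp: J_def max_sector_def)
      show "k \<notin> J" if "x - v i \<in> min_sector 0 k" for k
      proof -
        have "x \<in> min_sector (v i) k"
          using that by (simp add: min_sector_def)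
        then show ?thesis
          using disj by (auto simp: J_def)
      qed
    qed
    then show "x + t *\<^sub>R d \<in> (+) (v i) ` s i"
      by (rule rev_image_eqI) simp
  qed
  \<comment> \<open>Any single point yields an index in \<open>J\<close> and one outside it, so
    \<open>d\<close> is not a multiple of the all-ones vector and the ray does not collapse in the
    torus.\<close>
  fix i0 :: 'm
  have "Max (range (\<lambda>k. x $ k - v i0 $ k)) \<in> range (\<lambda>k. x $ k - v i0 $ k)"
    "Min (range (\<lambda>k. x $ k - v i0 $ k)) \<in> range (\<lambda>k. x $ k - v i0 $ k)"
    by (auto intro!: Max_in Min_in)
  then obtain j k where "x \<in> max_sector (v i0) j" "x \<in> min_sector (v i0) k"
    unfolding max_sector_iff_Max min_sector_iff_Min by blast
  then have jk: "j \<in> J" "k \<notin> J"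
    using disj by (auto simp: J_def)
  obtain B where B: "\<And>z. z \<in> C \<Longrightarrow> norm (tp_coords (tp_class z)) \<le> B"
    using bd by (auto simp: bounded_cell_def bounded_iff)
  have bound: "z $ j - z $ k \<le> 2 * B" if "z \<in> C" for z
    using tp_coords_diff[of z j k] B[OF that]
      component_le_norm_cart[of "tp_coords (tp_class z)" j]
      component_le_norm_cart[of "tp_coords (tp_class z)" k]
    by linarith
  \<comment> \<open>Moving by \<open>t\<close> raises the difference of coordinates \<open>j\<close>
    and \<open>k\<close> by exactly \<open>t\<close>, which this choice pushes beyond
    \<open>2 * B\<close>.\<close>
  define t where "t = \<bar>2 * B\<bar> + \<bar>x $ j - x $ k\<bar> + 1"
  have "t > 0"
    by (simp add: t_def)
  from bound[OF ray[OF this]] have "x $ j + t - x $ k \<le> 2 * B"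
    using jk by (simp add: d_def)
  then show False
    by (simp add: t_def)
qed

theorem theorem4:
  fixes v :: "'m::finite \<Rightarrow> real^'n" and L :: "real^'m"
    and C :: "(real^'n) set" and x0 :: "real^'n"
  assumes "\<forall>i. L $ i \<in> {0..1}"
    and "C \<in> cells v L"
    and "closed C"
    and "bounded_cell C"
    and "x0 \<in> C"
  shows "\<exists>w' L' :: real^'m. (\<forall>i. 0 \<le> w' $ i) \<and> w' \<noteq> 0 \<and> (\<forall>i. L' $ i \<in> {0..1})
           \<and> tp_class x0 \<in> TFW (\<lambda>i. tp_class (v i)) L' w'"
proof -
  obtain i i' j where "x0 \<in> max_sector (v i) j" "x0 \<in> min_sector (v i') j"
    using common_sector_of_bounded_cell[OF assms(2,4,5)] by blast
  then show ?thesis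
    by (rule exists_TFW_of_common_sector)
qed

end
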